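(* Let $0<\alpha<1$, $\tau>0$ and $x_0=(x_0^1,x_0^2,x_0^3,x_0^4,x_0^5)^T\in\mathbb{R}^5$. Then the initial value problem of the fractional $5D$ Maxwell-Bloch model $$D_t^{\alpha}x(t)=A\,x(t)+x^1(t)\,A_1\,x(t)+x^2(t)\,A_2\,x(t),\quad t\in(0,\tau),\qquad x(0)=x_0,$$ for the unknown $x(t)=(x^1(t),x^2(t),x^3(t),x^4(t),x^5(t))^T$, has a unique solution. Here $$A=\begin{pmatrix}0&0&1&0&0\\0&0&0&1&0\\0&0&0&0&0\\0&0&0&0&0\\0&0&0&0&0\end{pmatrix},\quad A_1=\begin{pmatrix}0&0&0&0&0\\0&0&0&0&0\\0&0&0&0&1\\0&0&0&0&0\\0&0&-1&0&0\end{pmatrix},\quad A_2=\begin{pmatrix}0&0&0&0&0\\0&0&0&0&0\\0&0&0&0&0\\0&0&0&0&1\\0&0&0&-1&0\end{pmatrix}.$$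
   Context: $D_t^{\alpha}$ denotes the Caputo fractional derivative of order $\alpha\in(0,1)$ with base point $0$, $D_t^{\alpha}f=J^{1-\alpha}f'$, where $J^{\beta}f(t)=\frac{1}{\Gamma(\beta)}\int_0^t(t-s)^{\beta-1}f(s)\,ds$ for $\beta>0$ is the Riemann-Liouville integral; it is applied componentwise. Superscripts on $x$ denote components. In components the system reads $D_t^{\alpha}x^1=x^3$, $D_t^{\alpha}x^2=x^4$, $D_t^{\alpha}x^3=x^1x^5$, $D_t^{\alpha}x^4=x^2x^5$, $D_t^{\alpha}x^5=-(x^1x^3+x^2x^4)$. An initial value problem $D_t^\alpha x=f(x)$, $x(0)=x_0$ with $f$ continuous is understood through the equivalent Volterra equation: a solution is a continuous function $x:[0,\tau)\to\mathbb{R}^5$ with $x(t)=x_0+\frac{1}{\Gamma(\alpha)}\int_0^t(t-s)^{\alpha-1}f(x(s))\,ds$ for all $t\in[0,\tau)$. *)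

theory Defs
  imports "HOL-Analysis.Analysis"
begin

text \<open>The kernel is singular at \<open>s = t\<close> when \<open>\<beta> < 1\<close>; the value \<open>0 powr (\<beta> - 1) = 0\<close> there
  affects only a null set. Vector-valued integrals are taken componentwise.\<close>
definition RL_integral ::
    "real \<Rightarrow> (real \<Rightarrow> 'a::{banach, second_countable_topology}) \<Rightarrow> real \<Rightarrow> 'a" where
  "RL_integral \<beta> f t =
     (1 / Gamma \<beta>) *\<^sub>R (LINT s:{0..t}|lborel. (t - s) powr (\<beta> - 1) *\<^sub>R f s)"

text \<open>A solution on \<open>[0, \<tau>)\<close> of the Caputo initial value problem \<open>D\<^sup>\<alpha> x = F x\<close>, \<open>x 0 = x0\<close>,
  for continuous \<open>F\<close>, understood through the equivalent Volterra equation. Only the values of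
  \<open>x\<close> on \<open>[0, \<tau>)\<close> matter; the equation at \<open>t = 0\<close> is the initial condition.\<close>
definition caputo_ivp_solution ::
    "real \<Rightarrow> ('a \<Rightarrow> 'a) \<Rightarrow> 'a \<Rightarrow> real \<Rightarrow>
      (real \<Rightarrow> 'a::{banach, second_countable_topology}) \<Rightarrow> bool" where
  "caputo_ivp_solution \<alpha> F x0 \<tau> x \<longleftrightarrow>
     continuous_on {0..<\<tau>} x \<and>
     (\<forall>t\<in>{0..<\<tau>}. x t = x0 + RL_integral \<alpha> (\<lambda>s. F (x s)) t)"

definition MB_A :: "real^5^5" where
  "MB_A = vector [vector [0, 0, 1, 0, 0],
                  vector [0, 0, 0, 1, 0],
                  vector [0, 0, 0, 0, 0],
                  vector [0, 0, 0, 0, 0],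
                  vector [0, 0, 0, 0, 0]]"

definition MB_A1 :: "real^5^5" where
  "MB_A1 = vector [vector [0, 0,  0, 0, 0],
                   vector [0, 0,  0, 0, 0],
                   vector [0, 0,  0, 0, 1],
                   vector [0, 0,  0, 0, 0],
                   vector [0, 0, -1, 0, 0]]"

definition MB_A2 :: "real^5^5" where
  "MB_A2 = vector [vector [0, 0, 0,  0, 0],
                   vector [0, 0, 0,  0, 0],
                   vector [0, 0, 0,  0, 0],
                   vector [0, 0, 0,  0, 1],
                   vector [0, 0, 0, -1, 0]]"

definition MB_field :: "real^5 \<Rightarrow> real^5" where
  "MB_field x = MB_A *v x + (x $ 1) *\<^sub>R (MB_A1 *v x) + (x $ 2) *\<^sub>R (MB_A2 *v x)"

lemma exhaust_5: fixes x :: 5 shows "x = 1 \<or> x = 2 \<or> x = 3 \<or> x = 4 \<or> x = 5"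
proof (induct x)
  case (of_int z)
  then have "z = 0 \<or> z = 1 \<or> z = 2 \<or> z = 3 \<or> z = 4" by simp arith
  then show ?case by auto
qed

lemma sum_5: "sum f (UNIV :: 5 set) = f 1 + f 2 + f 3 + f 4 + f 5"
proof -
  have u: "UNIV = {1, 2, 3, 4, 5 :: 5}" using exhaust_5 by auto
  show ?thesis unfolding u by (simp add: ac_simps)
qed

lemma vector_5:
  fixes a b c d e :: "'a::zero"
  shows "(vector [a, b, c, d, e] :: 'a^5) $ 1 = a" "(vector [a, b, c, d, e] :: 'a^5) $ 2 = b"
    "(vector [a, b, c, d, e] :: 'a^5) $ 3 = c" "(vector [a, b, c, d, e] :: 'a^5) $ 4 = d"
    "(vector [a, b, c, d, e] :: 'a^5) $ 5 = e"
  unfolding vector_def by simp_all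

lemma MB_field_components:
  "MB_field x $ 1 = x $ 3"
  "MB_field x $ 2 = x $ 4"
  "MB_field x $ 3 = x $ 1 * x $ 5"
  "MB_field x $ 4 = x $ 2 * x $ 5"
  "MB_field x $ 5 = - (x $ 1 * x $ 3 + x $ 2 * x $ 4)"
  unfolding MB_field_def MB_A_def MB_A1_def MB_A2_def
  by (simp_all only: matrix_vector_mult_def vector_add_component vector_scaleR_component
      vec_lambda_beta sum_5 vector_5, simp_all)

end

theory Submission
  imports Defs
begin

text \<open>Write \<open>J\<close> for the Riemann-Liouville integral of order \<open>\<alpha>\<close>. Picard iteration is a contraction in
  the norm \<open>sup exp (- l t) \<bar>x t\<bar>\<close> for large \<open>l\<close>, which settles globally Lipschitz fields. The
  Maxwell-Bloch field is only locally Lipschitz, so it is precomposed with the nearest-point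
  projection onto a large ball. The projection is radial, hence the part \<open>(x\<^sup>3, x\<^sup>4, x\<^sup>5)\<close> of the
  solution stays orthogonal to the corresponding part of the truncated field. The inequality
  \<open>(J g)\<^sup>2 \<le> 2 J (g \<cdot> J g)\<close> then shows that the norm of this part never exceeds its initial value,
  and the remaining two components are integrals of bounded functions. So the solution never leaves
  the ball and solves the original system.

  The inequality needs no regularity of \<open>g\<close> beyond continuity. With \<open>a = t - s\<close> its kernel
  \<open>a\<^bsup>\<alpha>-1\<^esup> (b - a)\<^bsup>\<alpha>-1\<^esup>\<close>, \<open>a < b\<close>, expands as \<open>(a b)\<^bsup>\<alpha>-1\<^esup> \<Sum>\<^sub>n c\<^sub>n (a / b)\<^bsup>n\<^esup>\<close> with
  \<open>c\<^sub>n \<ge> 0\<close>; every kernel \<open>(a / b)\<^bsup>n\<^esup>\<close> is positive definite, and the term \<open>n = 0\<close> is the square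
  \<open>(J g)\<^sup>2\<close>.\<close>

section \<open>The Riemann-Liouville integral\<close>

lemma set_integral_dominated_convergence:
  fixes f :: "'a \<Rightarrow> 'b::{banach, second_countable_topology}" and w :: "'a \<Rightarrow> real"
  assumes "set_borel_measurable M A f" "\<And>i. set_borel_measurable M A (s i)" "set_integrable M A w"
    and "AE x in M. x \<in> A \<longrightarrow> (\<lambda>i. s i x) \<longlonglongrightarrow> f x"
    and "\<And>i. AE x in M. x \<in> A \<longrightarrow> norm (s i x) \<le> w x"
  shows "(\<lambda>i. LINT x:A|M. s i x) \<longlonglongrightarrow> (LINT x:A|M. f x)"
  unfolding set_lebesgue_integral_def
proof (rule integral_dominated_convergence[where w = "\<lambda>x. indicator A x *\<^sub>R w x"])
  show "AE x in M. (\<lambda>i. indicator A x *\<^sub>R s i x) \<longlonglongrightarrow> indicator A x *\<^sub>R f x"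
    using assms(4) by eventually_elim (auto split: split_indicator)
  show "AE x in M. norm (indicator A x *\<^sub>R s i x) \<le> indicator A x *\<^sub>R w x" for i
    using assms(5)[of i] by eventually_elim (auto split: split_indicator)
qed (use assms in \<open>auto simp: set_borel_measurable_def set_integrable_def\<close>)

text \<open>The unsimplified argument \<open>c + - 1 * s\<close> is the form that the affine change
  of variables with factor \<open>-1\<close> produces.\<close>

lemma indicator_Icc_minus: "indicator {p..q} (c + - 1 * s) = indicator {c - q..c - p} (s::real)"
  by (auto split: split_indicator)

lemma set_integral_Icc_minus:
  fixes f :: "real \<Rightarrow> 'a::{banach, second_countable_topology}"
  shows "(LINT s:{p..q}|lborel. f s) = (LINT s:{c - q..c - p}|lborel. f (c - s))"
  unfolding set_lebesgue_integral_def
  by (subst lborel_integral_real_affine[where c = "-1" and t = c])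
     (simp_all only: indicator_Icc_minus, simp_all)

lemma set_integrable_Icc_minus:
  fixes f :: "real \<Rightarrow> 'a::{banach, second_countable_topology}"
  shows "set_integrable lborel {p..q} f \<longleftrightarrow> set_integrable lborel {c - q..c - p} (\<lambda>s. f (c - s))"
  unfolding set_integrable_def
  by (subst lborel_integrable_real_affine_iff[where c = "-1" and t = c, symmetric])
     (simp_all only: indicator_Icc_minus, simp_all)

text \<open>The gauge integral of the power is known, and for a nonnegative function it implies
  absolute integrability; Borel measurability then allows the passage from \<open>lebesgue\<close>
  to \<open>lborel\<close>.\<close>

lemma set_integrable_powr:
  fixes \<alpha> t :: real
  assumes "0 < \<alpha>"
  shows "set_integrable lborel {0..t} (\<lambda>u. u powr (\<alpha> - 1))"
proof (cases "0 \<le> t")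
  case True
  have "(\<lambda>u. u powr (\<alpha> - 1)) integrable_on {0..t}"
    using has_integral_powr_from_0[of "\<alpha> - 1" t] assms True by auto
  then have "set_integrable lebesgue {0..t} (\<lambda>u. u powr (\<alpha> - 1))"
    by (rule nonnegative_absolutely_integrable_1) auto
  then show ?thesis
    unfolding set_integrable_def by (subst (asm) integrable_completion) auto
qed (auto simp: set_integrable_def)

lemma bounded_on_Icc:
  fixes f :: "real \<Rightarrow> 'a::real_normed_vector"
  assumes "continuous_on {p..q} f"
  obtains M where "0 \<le> M" "\<And>s. s \<in> {p..q} \<Longrightarrow> norm (f s) \<le> M"
proof -
  have "bounded (f ` {p..q})"
    using assms by (intro compact_imp_bounded compact_continuous_image) auto
  then obtain M where M: "\<And>s. s \<in> {p..q} \<Longrightarrow> norm (f s) \<le> M"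
    by (fastforce simp: bounded_iff)
  show ?thesis
    by (rule that[of "max M 0"]) (use M in \<open>auto simp: le_max_iff_disj\<close>)
qed

lemma set_borel_measurable_scaleR:
  fixes k :: "real \<Rightarrow> real" and f :: "real \<Rightarrow> 'a::{banach, second_countable_topology}"
  assumes [measurable]: "k \<in> borel_measurable borel" and "set_borel_measurable lborel A f"
  shows "set_borel_measurable lborel A (\<lambda>s. k s *\<^sub>R f s)"
proof -
  have "(\<lambda>s. indicator A s *\<^sub>R k s *\<^sub>R f s) = (\<lambda>s. k s *\<^sub>R indicator A s *\<^sub>R f s)"
    by (auto simp: scaleR_left_commute)
  then show ?thesis
    using assms(2) unfolding set_borel_measurable_def by (simp del: scaleR_scaleR)
qed

lemma set_integrable_scaleR_continuous:
  fixes f :: "real \<Rightarrow> 'a::{banach, second_countable_topology}"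
  assumes "set_integrable lborel {p..q} k" and [measurable]: "k \<in> borel_measurable borel"
    and "continuous_on {p..q} f"
  shows "set_integrable lborel {p..q} (\<lambda>s. k s *\<^sub>R f s)"
proof -
  obtain M where M: "0 \<le> M" "\<And>s. s \<in> {p..q} \<Longrightarrow> norm (f s) \<le> M"
    using bounded_on_Icc[OF assms(3)] by blast
  show ?thesis
  proof (rule set_integrable_bound[of _ _ "\<lambda>s. M * k s"])
    show "set_integrable lborel {p..q} (\<lambda>s. M * k s)"
      using assms(1) by simp
    show "set_borel_measurable lborel {p..q} (\<lambda>s. k s *\<^sub>R f s)"
      using borel_measurable_continuous_on_indicator[OF _ assms(3)]
      by (intro set_borel_measurable_scaleR) (auto simp: set_borel_measurable_def)
    show "AE s in lborel. s \<in> {p..q} \<longrightarrow> norm (k s *\<^sub>R f s) \<le> norm (M * k s)"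
      using M by (intro AE_I2 impI) (auto simp: abs_mult mult.commute[of M] intro!: mult_left_mono)
  qed
qed

section \<open>Integrability and linearity of the fractional integral\<close>

lemma RL_kernel_integrable:
  fixes t :: real
  assumes "0 < \<alpha>"
  shows "set_integrable lborel {0..t} (\<lambda>s. (t - s) powr (\<alpha> - 1))"
  using set_integrable_powr[OF assms, of t] set_integrable_Icc_minus[of 0 t "\<lambda>u. u powr (\<alpha> - 1)" t]
  by simp

lemma RL_integrable:
  fixes f :: "real \<Rightarrow> 'a::{banach, second_countable_topology}"
  assumes "0 < \<alpha>" "continuous_on {0..t} f"
  shows "set_integrable lborel {0..t} (\<lambda>s. (t - s) powr (\<alpha> - 1) *\<^sub>R f s)"
  using assms by (intro set_integrable_scaleR_continuous RL_kernel_integrable) auto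

lemma RL_integral_diff:
  fixes f g :: "real \<Rightarrow> 'a::{banach, second_countable_topology}"
  assumes "0 < \<alpha>" "continuous_on {0..t} f" "continuous_on {0..t} g"
  shows "RL_integral \<alpha> f t - RL_integral \<alpha> g t = RL_integral \<alpha> (\<lambda>s. f s - g s) t"
  using RL_integrable[OF assms(1,2)] RL_integrable[OF assms(1,3)]
  by (simp add: RL_integral_def scaleR_diff_right set_integral_diff(2))

lemma RL_integral_bounded_linear:
  fixes f :: "real \<Rightarrow> 'a::{banach, second_countable_topology}"
    and T :: "'a \<Rightarrow> 'b::{banach, second_countable_topology}"
  assumes "bounded_linear T" "0 < \<alpha>" "continuous_on {0..t} f"
  shows "T (RL_integral \<alpha> f t) = RL_integral \<alpha> (\<lambda>s. T (f s)) t"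
proof -
  interpret bounded_linear T by fact
  show ?thesis
    using integral_bounded_linear[OF assms(1) RL_integrable[OF assms(2,3), unfolded set_integrable_def]]
    by (simp add: RL_integral_def set_lebesgue_integral_def scaleR)
qed

lemma RL_integral_cong:
  assumes "\<And>s. s \<in> {0..t} \<Longrightarrow> f s = g s"
  shows "RL_integral \<alpha> f t = RL_integral \<alpha> g t"
  unfolding RL_integral_def using assms by (auto intro!: set_lebesgue_integral_cong)

text \<open>The factor by which the order \<open>\<alpha>\<close> integral can increase a norm with weight \<open>exp (- l t)\<close> on
  \<open>[0, T]\<close>.\<close>
definition exp_kernel :: "real \<Rightarrow> real \<Rightarrow> real \<Rightarrow> real" where
  "exp_kernel \<alpha> l T = (LINT u:{0..T}|lborel. u powr (\<alpha> - 1) * exp (- (l * u))) / Gamma \<alpha>"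

lemma exp_kernel_integrable:
  fixes \<alpha> l T :: real
  assumes "0 < \<alpha>"
  shows "set_integrable lborel {0..T} (\<lambda>u. u powr (\<alpha> - 1) * exp (- (l * u)))"
  using set_integrable_scaleR_continuous[OF set_integrable_powr[OF assms, of T], of "\<lambda>u. exp (- (l * u))"]
  by (simp add: continuous_intros)

lemma exp_kernel_nonneg:
  assumes "0 < \<alpha>" shows "0 \<le> exp_kernel \<alpha> l T"
  unfolding exp_kernel_def set_lebesgue_integral_def
  using Gamma_real_pos[OF assms] by (auto intro!: divide_nonneg_pos integral_nonneg split: split_indicator)

lemma exp_kernel_tendsto_0:
  assumes "0 < \<alpha>"
  shows "(\<lambda>n. exp_kernel \<alpha> (real n) T) \<longlonglongrightarrow> 0"
proof -
  have "(\<lambda>n. LINT u:{0..T}|lborel. u powr (\<alpha> - 1) * exp (- (real n * u)))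
      \<longlonglongrightarrow> (LINT u:{0..T}|lborel. 0)"
  proof (rule set_integral_dominated_convergence)
    show "set_integrable lborel {0..T} (\<lambda>u. u powr (\<alpha> - 1))"
      by (rule set_integrable_powr[OF assms])
    have "(\<lambda>n. u powr (\<alpha> - 1) * exp (- (real n * u))) \<longlonglongrightarrow> 0" if "0 \<le> u" for u
    \<comment> \<open>At \<open>u = 0\<close> the exponential stays equal to 1, but
      \<open>0 powr (\<alpha> - 1)\<close> is 0, so the limit holds there as well.\<close>
    proof (cases "u = 0")
      case False
      then have "(\<lambda>n. u powr (\<alpha> - 1) * exp (- u) ^ n) \<longlonglongrightarrow> u powr (\<alpha> - 1) * 0"
        using that by (intro tendsto_mult tendsto_const LIMSEQ_realpow_zero) auto
      then show ?thesis by (simp add: exp_of_nat_mult[symmetric])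
    qed simp
    then show "AE u in lborel. u \<in> {0..T} \<longrightarrow>
        (\<lambda>n. u powr (\<alpha> - 1) * exp (- (real n * u))) \<longlonglongrightarrow> 0"
      by auto
    show "AE u in lborel. u \<in> {0..T} \<longrightarrow>
        norm (u powr (\<alpha> - 1) * exp (- (real n * u))) \<le> u powr (\<alpha> - 1)" for n
      by (auto simp: abs_mult intro!: AE_I2 mult_left_le)
  qed (auto simp: set_borel_measurable_def)
  from tendsto_divide[OF this tendsto_const[of "Gamma \<alpha>"]] Gamma_real_pos[OF assms]
  show ?thesis by (simp add: exp_kernel_def set_lebesgue_integral_def)
qed

text \<open>Splitting \<open>exp (l * s)\<close> as
  \<open>exp (l * t) * exp (- (l * (t - s)))\<close> leaves the weighted kernel in the lag
  \<open>t - s\<close>. Enlarging its domain from \<open>{0..t}\<close> to \<open>{0..T}\<close>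
  makes the factor independent of \<open>t\<close>. For \<open>l = 0\<close> this is a plain
  supremum bound.\<close>

lemma norm_RL_integral_le:
  fixes f :: "real \<Rightarrow> 'a::{banach, second_countable_topology}"
  assumes "0 < \<alpha>" "0 \<le> t" "t \<le> T" "continuous_on {0..t} f"
    and bound: "\<And>s. s \<in> {0..t} \<Longrightarrow> norm (f s) \<le> M * exp (l * s)"
  shows "norm (RL_integral \<alpha> f t) \<le> M * exp (l * t) * exp_kernel \<alpha> l T"
proof -
  define K where "K s = s powr (\<alpha> - 1) * exp (- (l * s))" for s
  have G: "Gamma \<alpha> > 0" using assms(1) by (rule Gamma_real_pos)
  have "norm (f 0) \<le> M" using bound[of 0] assms(2) by auto
  then have M: "0 \<le> M" using norm_ge_zero order_trans by blast
  have K_int: "set_integrable lborel {0..T'} K" for T'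
    unfolding K_def by (rule exp_kernel_integrable[OF assms(1)])
  have Kt: "set_integrable lborel {0..t} (\<lambda>s. K (t - s))"
    using K_int[of t] set_integrable_Icc_minus[of 0 t K t] by simp
  have "norm (LINT s:{0..t}|lborel. (t - s) powr (\<alpha> - 1) *\<^sub>R f s)
      \<le> (LINT s:{0..t}|lborel. norm ((t - s) powr (\<alpha> - 1) *\<^sub>R f s))"
    by (rule set_integral_norm_bound[OF RL_integrable[OF assms(1,4)]])
  also have "\<dots> \<le> (LINT s:{0..t}|lborel. M * exp (l * t) * K (t - s))"
  proof (rule set_integral_mono)
    show "set_integrable lborel {0..t} (\<lambda>s. norm ((t - s) powr (\<alpha> - 1) *\<^sub>R f s))"
      by (rule set_integrable_norm[OF RL_integrable[OF assms(1,4)]])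
    show "set_integrable lborel {0..t} (\<lambda>s. M * exp (l * t) * K (t - s))"
      using Kt by simp
    fix s assume s: "s \<in> {0..t}"
    have "exp (l * s) = exp (l * t) * exp (- (l * (t - s)))"
      by (simp add: exp_add[symmetric] algebra_simps)
    then show "norm ((t - s) powr (\<alpha> - 1) *\<^sub>R f s) \<le> M * exp (l * t) * K (t - s)"
      using mult_left_mono[OF bound[OF s], of "(t - s) powr (\<alpha> - 1)"] by (simp add: K_def mult_ac)
  qed
  also have "\<dots> = M * exp (l * t) * (LINT s:{0..t}|lborel. K s)"
    using set_integral_Icc_minus[of 0 t K t] by simp
  also have "\<dots> \<le> M * exp (l * t) * (LINT s:{0..T}|lborel. K s)"
  proof (rule mult_left_mono)
    show "(LINT s:{0..t}|lborel. K s) \<le> (LINT s:{0..T}|lborel. K s)"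
      unfolding set_lebesgue_integral_def
      using K_int[of t] K_int[of T] assms(3) unfolding set_integrable_def
      by (intro integral_mono) (auto simp: K_def split: split_indicator)
  qed (use M in auto)
  finally show ?thesis
    using G by (simp add: RL_integral_def exp_kernel_def K_def divide_right_mono)
qed

text \<open>The substitution \<open>s = t * v\<close> fixes the domain and the singularity, so that
  \<open>t\<close> occurs only in a power and in the argument of \<open>f\<close>. This is the form
  in which continuity in \<open>t\<close> can be read off.\<close>

lemma RL_integral_rescale:
  fixes f :: "real \<Rightarrow> 'a::{banach, second_countable_topology}"
  assumes "0 < \<alpha>" "0 \<le> t"
  shows "RL_integral \<alpha> f t =
    (t powr \<alpha> / Gamma \<alpha>) *\<^sub>R (LINT v:{0..1}|lborel. (1 - v) powr (\<alpha> - 1) *\<^sub>R f (t * v))"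
proof (cases "t = 0")
  case True
  have *: "(\<lambda>s. (indicat_real {0} s * (- s) powr (\<alpha> - 1)) *\<^sub>R f s) = (\<lambda>_. 0)"
    by (auto split: split_indicator)
  have "(LINT s:{0..0}|lborel. (0 - s) powr (\<alpha> - 1) *\<^sub>R f s) = 0"
    unfolding set_lebesgue_integral_def by (simp add: *)
  then show ?thesis using True assms by (simp add: RL_integral_def)
next
  case False
  then have t: "0 < t" using assms by simp
  have ind: "indicator {0..t} (t * v) = (indicator {0..1} v :: real)" for v
    using t by (auto simp: zero_le_mult_iff mult_le_cancel_left2 split: split_indicator)
  have "(t - t * v) powr (\<alpha> - 1) = t powr (\<alpha> - 1) * (1 - v) powr (\<alpha> - 1)" if "v \<le> 1" for v
    using t that powr_mult[of t "1 - v" "\<alpha> - 1"] by (simp add: algebra_simps)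
  then have "(\<lambda>v. indicator {0..t} (t * v) *\<^sub>R (t - t * v) powr (\<alpha> - 1) *\<^sub>R f (t * v)) =
      (\<lambda>v. t powr (\<alpha> - 1) *\<^sub>R indicator {0..1} v *\<^sub>R (1 - v) powr (\<alpha> - 1) *\<^sub>R f (t * v))"
    unfolding ind by (auto split: split_indicator)
  moreover have "t * t powr (\<alpha> - 1) = t powr \<alpha>"
    using t by (simp add: powr_diff)
  then have "(1 / Gamma \<alpha>) *\<^sub>R t *\<^sub>R t powr (\<alpha> - 1) *\<^sub>R X = (t powr \<alpha> / Gamma \<alpha>) *\<^sub>R X" for X :: 'a
    by (simp add: mult.assoc)
  ultimately show ?thesis
    unfolding RL_integral_def set_lebesgue_integral_def
    using t by (subst lborel_integral_real_affine[where c = t and t = 0])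
      (auto simp del: scaleR_scaleR)
qed

text \<open>After rescaling, dominated convergence with majorant
  \<open>M * (1 - v) powr (\<alpha> - 1)\<close> gives sequential continuity of the integral; the
  factor \<open>t powr \<alpha>\<close> is continuous up to \<open>t = 0\<close> because the
  exponent is positive.\<close>

lemma continuous_on_RL_integral:
  fixes f :: "real \<Rightarrow> 'a::{banach, second_countable_topology}"
  assumes "0 < \<alpha>" "continuous_on {0..T} f"
  shows "continuous_on {0..T} (RL_integral \<alpha> f)"
proof -
  let ?I = "\<lambda>t. LINT v:{0..1}|lborel. (1 - v) powr (\<alpha> - 1) *\<^sub>R f (t * v)"
  obtain M where M: "\<And>s. s \<in> {0..T} \<Longrightarrow> norm (f s) \<le> M"
    using bounded_on_Icc[OF assms(2)] by blast
  have in_T: "t * v \<in> {0..T}" if "t \<in> {0..T}" "v \<in> {0..1}" for t v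
    using that mult_mono[of t T v 1] by auto
  have cont: "continuous_on {0..1} (\<lambda>v. f (t * v))" if "t \<in> {0..T}" for t
    using that by (intro continuous_on_compose2[OF assms(2)] continuous_intros) (auto intro!: in_T)
  have meas: "set_borel_measurable lborel {0..1} (\<lambda>v. (1 - v) powr (\<alpha> - 1) *\<^sub>R f (t * v))"
    if "t \<in> {0..T}" for t
    using borel_measurable_continuous_on_indicator[OF _ cont[OF that]]
    by (intro set_borel_measurable_scaleR) (auto simp: set_borel_measurable_def)
  have "continuous_on {0..T} ?I"
    unfolding continuous_on_sequentially o_def
  proof safe
    fix X and t :: real
    assume t: "t \<in> {0..T}" and X: "\<forall>n. X n \<in> {0..T}" and lim: "X \<longlonglongrightarrow> t"
    show "(\<lambda>n. ?I (X n)) \<longlonglongrightarrow> ?I t"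
    proof (rule set_integral_dominated_convergence)
      show "set_integrable lborel {0..1} (\<lambda>v. M * (1 - v) powr (\<alpha> - 1))"
        using RL_kernel_integrable[OF assms(1), of 1] by simp
      have "(\<lambda>n. f (X n * v)) \<longlonglongrightarrow> f (t * v)" if "v \<in> {0..1}" for v
        using that t X by (intro continuous_on_tendsto_compose[OF assms(2)] tendsto_intros lim)
          (auto simp del: atLeastAtMost_iff intro!: in_T always_eventually)
      then show "AE v in lborel. v \<in> {0..1} \<longrightarrow>
          (\<lambda>n. (1 - v) powr (\<alpha> - 1) *\<^sub>R f (X n * v)) \<longlonglongrightarrow> (1 - v) powr (\<alpha> - 1) *\<^sub>R f (t * v)"
        by (intro AE_I2 impI tendsto_scaleR tendsto_const) auto
      show "AE v in lborel. v \<in> {0..1} \<longrightarrow>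
          norm ((1 - v) powr (\<alpha> - 1) *\<^sub>R f (X n * v)) \<le> M * (1 - v) powr (\<alpha> - 1)" for n
        using M[OF in_T] X by (intro AE_I2 impI) (auto simp: mult.commute[of M] intro!: mult_left_mono)
    qed (use meas t X in auto)
  qed
  moreover have "continuous_on {0..T} (\<lambda>t. t powr \<alpha>)"
    by (intro continuous_on_powr' continuous_on_id continuous_on_const) (use assms(1) in auto)
  moreover have "Gamma \<alpha> \<noteq> 0"
    using Gamma_real_pos[OF assms(1)] by linarith
  ultimately have "continuous_on {0..T} (\<lambda>t. (t powr \<alpha> / Gamma \<alpha>) *\<^sub>R ?I t)"
    by (intro continuous_on_scaleR continuous_on_divide continuous_on_const) auto
  then show ?thesis
    by (rule continuous_on_eq) (use assms(1) in \<open>auto simp: RL_integral_rescale\<close>)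
qed

section \<open>Volterra equations with a Lipschitz right-hand side\<close>

text \<open>Supplies the weight rate \<open>l\<close> for which the Picard map of an
  \<open>L\<close>-Lipschitz field contracts with constant 1/2.\<close>

lemma exp_kernel_small:
  assumes "0 < \<alpha>" "0 \<le> L"
  obtains l where "0 \<le> l" "L * exp_kernel \<alpha> l T \<le> 1 / 2"
proof -
  have "(\<lambda>n. L * exp_kernel \<alpha> (real n) T) \<longlonglongrightarrow> L * 0"
    by (intro tendsto_mult tendsto_const exp_kernel_tendsto_0 assms)
  then have "eventually (\<lambda>n. L * exp_kernel \<alpha> (real n) T < 1 / 2) sequentially"
    by (rule order_tendstoD) auto
  then obtain n where "L * exp_kernel \<alpha> (real n) T < 1 / 2"
    by (auto simp: eventually_sequentially)
  then show ?thesis by (intro that[of "real n"]) auto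
qed

text \<open>The contraction estimate. The Lipschitz set \<open>S\<close> is kept general: existence
  takes the whole space, uniqueness a ball containing both solutions.\<close>

lemma norm_RL_integral_diff_le:
  fixes F :: "'a::{banach, second_countable_topology} \<Rightarrow> 'a"
  assumes "0 < \<alpha>" "0 \<le> t" "t \<le> T" "L-lipschitz_on S F"
    and "continuous_on {0..t} x" "continuous_on {0..t} y"
    and "x ` {0..t} \<subseteq> S" "y ` {0..t} \<subseteq> S"
    and bound: "\<And>s. s \<in> {0..t} \<Longrightarrow> norm (x s - y s) \<le> M * exp (l * s)"
  shows "norm (RL_integral \<alpha> (\<lambda>s. F (x s)) t - RL_integral \<alpha> (\<lambda>s. F (y s)) t)
    \<le> M * exp (l * t) * (L * exp_kernel \<alpha> l T)"
proof -
  have F: "continuous_on S F" using assms(4) by (rule lipschitz_on_continuous_on)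
  have cont: "continuous_on {0..t} (\<lambda>s. F (x s))" "continuous_on {0..t} (\<lambda>s. F (y s))"
    using assms(5-8) by (auto intro: continuous_on_compose2[OF F])
  have "norm (F (x s) - F (y s)) \<le> L * M * exp (l * s)" if "s \<in> {0..t}" for s
  proof -
    have "norm (F (x s) - F (y s)) \<le> L * norm (x s - y s)"
      using lipschitz_onD[OF assms(4), of "x s" "y s"] assms(7,8) that
      by (simp add: dist_norm image_subset_iff)
    also have "\<dots> \<le> L * (M * exp (l * s))"
      using lipschitz_on_nonneg[OF assms(4)] bound[OF that] by (rule mult_left_mono[rotated])
    finally show ?thesis by simp
  qed
  then have "norm (RL_integral \<alpha> (\<lambda>s. F (x s) - F (y s)) t)
      \<le> L * M * exp (l * t) * exp_kernel \<alpha> l T"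
    using assms(1-3) cont by (intro norm_RL_integral_le continuous_on_diff) auto
  then show ?thesis
    using RL_integral_diff[OF assms(1) cont] by (simp add: mult_ac)
qed

text \<open>The weighted distance \<open>w\<close> of the two solutions attains its maximum at some
  \<open>m\<close>. The contraction estimate at \<open>m\<close> bounds \<open>w m\<close> by half
  of itself, so \<open>w\<close> vanishes.\<close>

lemma volterra_unique:
  fixes F :: "'a::{banach, second_countable_topology} \<Rightarrow> 'a"
  assumes "0 < \<alpha>" "0 \<le> T" "L-lipschitz_on S F"
    and x: "continuous_on {0..T} x" "x ` {0..T} \<subseteq> S"
      "\<And>t. t \<in> {0..T} \<Longrightarrow> x t = x0 + RL_integral \<alpha> (\<lambda>s. F (x s)) t"
    and y: "continuous_on {0..T} y" "y ` {0..T} \<subseteq> S"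
      "\<And>t. t \<in> {0..T} \<Longrightarrow> y t = x0 + RL_integral \<alpha> (\<lambda>s. F (y s)) t"
    and "t \<in> {0..T}"
  shows "x t = y t"
proof -
  obtain l where l: "0 \<le> l" "L * exp_kernel \<alpha> l T \<le> 1 / 2"
    using exp_kernel_small[OF assms(1) lipschitz_on_nonneg[OF assms(3)]] by blast
  define w where "w s = norm (x s - y s) * exp (- (l * s))" for s
  have "continuous_on {0..T} w"
    unfolding w_def by (intro continuous_intros x y)
  then obtain m where m: "m \<in> {0..T}" "\<And>s. s \<in> {0..T} \<Longrightarrow> w s \<le> w m"
    using continuous_attains_sup[of "{0..T}" w] assms(2) by auto
  have w: "norm (x s - y s) = w s * exp (l * s)" for s
    by (simp add: w_def mult.assoc flip: exp_add)
  have "norm (x m - y m) \<le> w m * exp (l * m) * (L * exp_kernel \<alpha> l T)"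
  proof -
    have "norm (RL_integral \<alpha> (\<lambda>s. F (x s)) m - RL_integral \<alpha> (\<lambda>s. F (y s)) m)
        \<le> w m * exp (l * m) * (L * exp_kernel \<alpha> l T)"
    proof (rule norm_RL_integral_diff_le[OF assms(1) _ _ assms(3)])
      show "norm (x s - y s) \<le> w m * exp (l * s)" if "s \<in> {0..m}" for s
        using m that by (auto simp: w)
    qed (use m x(1,2) y(1,2) in \<open>auto intro: continuous_on_subset simp: image_subset_iff\<close>)
    then show ?thesis using m x(3) y(3) by simp
  qed
  also have "\<dots> \<le> w m * exp (l * m) * (1 / 2)"
    by (intro mult_left_mono l) (auto simp: w_def)
  finally have "w m \<le> 0"
    by (simp add: w field_simps) (simp add: mult_le_0_iff)
  then have "w t \<le> 0" using m(2)[OF assms(10)] by simp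
  then show ?thesis by (simp add: w_def mult_le_0_iff)
qed

text \<open>Writing the unknown as \<open>exp (l * t)\<close> times \<open>u\<close> turns the
  weighted norm into the supremum norm, so Banach's fixed point theorem applies in the complete
  space of bounded continuous functions.\<close>

lemma volterra_exists:
  fixes F :: "'a::{banach, second_countable_topology} \<Rightarrow> 'a"
  assumes "0 < \<alpha>" "0 \<le> T" "L-lipschitz_on UNIV F"
  obtains x where "continuous_on {0..T} x"
    "\<And>t. t \<in> {0..T} \<Longrightarrow> x t = x0 + RL_integral \<alpha> (\<lambda>s. F (x s)) t"
proof -
  obtain l where l: "0 \<le> l" "L * exp_kernel \<alpha> l T \<le> 1 / 2"
    using exp_kernel_small[OF assms(1) lipschitz_on_nonneg[OF assms(3)]] by blast
  \<comment> \<open>Bounded continuous functions live on the whole line. Clamping time to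
    \<open>{0..T}\<close> extends the Picard image by constants.\<close>
  define c where "c t = max 0 (min T t)" for t
  have c: "c t \<in> {0..T}" "t \<in> {0..T} \<Longrightarrow> c t = t" for t
    using assms(2) by (auto simp: c_def)
  have F: "continuous_on A F" for A
    using lipschitz_on_continuous_on[OF assms(3)] by (rule continuous_on_subset) auto
  \<comment> \<open>The Picard map conjugated by the exponential weight.\<close>
  define P where "P u t = exp (- (l * t)) *\<^sub>R (x0 + RL_integral \<alpha> (\<lambda>s. F (exp (l * s) *\<^sub>R u s)) t)"
    for u and t :: real
  have P: "(\<lambda>t. P (apply_bcontfun u) (c t)) \<in> bcontfun" for u :: "real \<Rightarrow>\<^sub>C 'a"
  proof -
    have *: "continuous_on {0..T} (P (apply_bcontfun u))"
      unfolding P_def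
      by (intro continuous_intros continuous_on_RL_integral assms continuous_on_compose2[OF F])
         auto
    obtain M where "\<And>s. s \<in> {0..T} \<Longrightarrow> norm (P (apply_bcontfun u) s) \<le> M"
      using bounded_on_Icc[OF *] by blast
    moreover have "continuous_on UNIV (\<lambda>t. P (apply_bcontfun u) (c t))"
      using c(1) by (intro continuous_on_compose2[OF *]) (auto simp: c_def intro!: continuous_intros)
    ultimately show ?thesis
      using c(1) by (intro bcontfun_normI[where b = M]) auto
  qed
  define \<Phi> where "\<Phi> u = Bcontfun (\<lambda>t. P (apply_bcontfun u) (c t))" for u
  have \<Phi>: "apply_bcontfun (\<Phi> u) t = P (apply_bcontfun u) (c t)" for u t
    unfolding \<Phi>_def using P by (simp add: Bcontfun_inverse)
  have "dist (\<Phi> u) (\<Phi> v) \<le> 1 / 2 * dist u v" for u v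
  proof (rule dist_bound)
    fix t
    let ?t = "c t" and ?u = "\<lambda>s. exp (l * s) *\<^sub>R apply_bcontfun u s"
      and ?v = "\<lambda>s. exp (l * s) *\<^sub>R apply_bcontfun v s"
    have "norm (RL_integral \<alpha> (\<lambda>s. F (?u s)) ?t - RL_integral \<alpha> (\<lambda>s. F (?v s)) ?t)
        \<le> dist u v * exp (l * ?t) * (L * exp_kernel \<alpha> l T)"
    proof (rule norm_RL_integral_diff_le[OF assms(1) _ _ assms(3)])
      show "norm (?u s - ?v s) \<le> dist u v * exp (l * s)" for s
        using dist_bounded[of u s v] by (simp add: dist_norm mult.commute flip: scaleR_diff_right)
    qed (use c in \<open>auto intro!: continuous_intros\<close>)
    also have "\<dots> \<le> dist u v * exp (l * ?t) * (1 / 2)"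
      by (intro mult_left_mono l) auto
    finally have *: "norm (RL_integral \<alpha> (\<lambda>s. F (?u s)) ?t - RL_integral \<alpha> (\<lambda>s. F (?v s)) ?t)
        \<le> dist u v * exp (l * ?t) * (1 / 2)" .
    have "dist (\<Phi> u t) (\<Phi> v t) = exp (- (l * ?t)) *
        norm (RL_integral \<alpha> (\<lambda>s. F (?u s)) ?t - RL_integral \<alpha> (\<lambda>s. F (?v s)) ?t)"
      by (simp add: \<Phi> P_def dist_norm flip: scaleR_diff_right)
    also have "\<dots> \<le> exp (- (l * ?t)) * (dist u v * exp (l * ?t) * (1 / 2))"
      using * by (rule mult_left_mono) auto
    also have "\<dots> = 1 / 2 * dist u v"
      by (simp add: exp_minus)
    finally show "dist (\<Phi> u t) (\<Phi> v t) \<le> 1 / 2 * dist u v" .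
  qed
  then obtain u where u: "\<Phi> u = u"
    using banach_fix_type[of "1 / 2" \<Phi>] by auto
  show ?thesis
  proof (rule that[of "\<lambda>t. exp (l * t) *\<^sub>R apply_bcontfun u t"])
    fix t assume "t \<in> {0..T}"
    then have "apply_bcontfun u t = P (apply_bcontfun u) t"
      using \<Phi>[of u t] u c(2) by simp
    then show "exp (l * t) *\<^sub>R apply_bcontfun u t =
        x0 + RL_integral \<alpha> (\<lambda>s. F (exp (l * s) *\<^sub>R apply_bcontfun u s)) t"
      by (simp add: P_def flip: exp_add)
  qed (auto intro!: continuous_intros)
qed

section \<open>Positivity of the kernel\<close>

text \<open>The difference of the two sides is the integral of \<open>2 n a\<^bsup>2n-1\<^esup> (W a)\<^sup>2\<close>, because
  \<open>a\<^bsup>2n\<^esup> (W a)\<^sup>2\<close> is a primitive of \<open>2 n a\<^bsup>2n-1\<^esup> (W a)\<^sup>2 - 2 a\<^bsup>n\<^esup> \<phi> a W a\<close>. Staying away from \<open>0\<close>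
  keeps \<open>\<phi> b / b\<^bsup>n\<^esup>\<close> continuous.\<close>
lemma weighted_square_le_integral:
  fixes \<phi> :: "real \<Rightarrow> real" and n :: nat
  assumes "0 < e" "e \<le> t" "continuous_on {e..t} \<phi>"
  defines "W \<equiv> \<lambda>a. integral {a..t} (\<lambda>b. \<phi> b / b ^ n)"
  shows "continuous_on {e..t} W"
    and "e ^ (2 * n) * (W e)\<^sup>2 \<le> 2 * integral {e..t} (\<lambda>a. a ^ n * \<phi> a * W a)"
proof -
  have cont: "continuous_on {e..t} (\<lambda>b. \<phi> b / b ^ n)"
    using assms(1) by (intro continuous_intros assms(3)) auto
  have deriv: "(W has_real_derivative - (\<phi> a / a ^ n)) (at a within {e..t})" if "a \<in> {e..t}" for a
    unfolding W_def has_real_derivative_iff_has_vector_derivative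
    using integral_has_vector_derivative'[OF cont] that by auto
  show W: "continuous_on {e..t} W"
    by (rule DERIV_continuous_on[OF deriv])
  \<comment> \<open>For \<open>n = 0\<close> the exponent \<open>2 * n - 1\<close> is truncated to
    0; the factor \<open>real (2 * n)\<close> makes the term vanish anyway.\<close>
  let ?R = "\<lambda>a. real (2 * n) * a ^ (2 * n - 1) * (W a)\<^sup>2" and ?g = "\<lambda>a. a ^ n * \<phi> a * W a"
  have "((\<lambda>a. ?R a - 2 * ?g a) has_integral t ^ (2 * n) * (W t)\<^sup>2 - e ^ (2 * n) * (W e)\<^sup>2) {e..t}"
  proof (rule fundamental_theorem_of_calculus[OF assms(2)])
    fix a assume a: "a \<in> {e..t}"
    then have "\<phi> a / a ^ n * a ^ (2 * n) = a ^ n * \<phi> a"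
      using assms(1) by (simp add: mult_2 power_add)
    moreover have "2 * W a * - (\<phi> a / a ^ n) * a ^ (2 * n) = - 2 * W a * (\<phi> a / a ^ n * a ^ (2 * n))"
      by (simp only: mult_minus_left mult_minus_right mult.assoc)
    ultimately have "?R a - 2 * ?g a =
        real (2 * n) * a ^ (2 * n - 1) * (W a)\<^sup>2 + 2 * W a * - (\<phi> a / a ^ n) * a ^ (2 * n)"
      by (simp only: mult_minus_left diff_conv_add_uminus mult_ac)
    moreover have "((\<lambda>a. a ^ (2 * n) * (W a)\<^sup>2) has_real_derivative
        real (2 * n) * a ^ (2 * n - 1) * (W a)\<^sup>2 + 2 * W a * - (\<phi> a / a ^ n) * a ^ (2 * n))
        (at a within {e..t})"
      by (auto intro!: derivative_eq_intros deriv a)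
    ultimately show "((\<lambda>a. a ^ (2 * n) * (W a)\<^sup>2) has_vector_derivative ?R a - 2 * ?g a)
        (at a within {e..t})"
      by (simp only: has_real_derivative_iff_has_vector_derivative)
  qed
  \<comment> \<open>The boundary term at \<open>t\<close> drops out, which leaves only the square at
    \<open>e\<close>.\<close>
  moreover have "W t = 0" by (simp add: W_def)
  moreover have "?g integrable_on {e..t}"
    by (intro integrable_continuous_real continuous_intros assms(3) W)
  then have "((\<lambda>a. 2 * ?g a) has_integral 2 * integral {e..t} ?g) {e..t}"
    by (intro has_integral_mult_right integrable_integral)
  ultimately have "(?R has_integral - (e ^ (2 * n) * (W e)\<^sup>2) + 2 * integral {e..t} ?g) {e..t}"
    using has_integral_add[of "\<lambda>a. ?R a - 2 * ?g a" _ "{e..t}" "\<lambda>a. 2 * ?g a"]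
    by (simp only: diff_add_cancel mult_zero_right power_zero_numeral diff_0)
  then have "0 \<le> - (e ^ (2 * n) * (W e)\<^sup>2) + 2 * integral {e..t} ?g"
    by (rule has_integral_nonneg) (use assms(1) in auto)
  then show "e ^ (2 * n) * (W e)\<^sup>2 \<le> 2 * integral {e..t} ?g" by simp
qed

text \<open>Each kernel \<open>(a / b) ^ n\<close> separates the variables, so \<open>V\<close> is a
  combination of the functions of the preceding lemma, and every term contributes a nonnegative
  amount. The term \<open>n = 0\<close>, always present in a sum below \<open>Suc N\<close>, already
  yields the square.\<close>

lemma integral_square_le_power_series_kernel:
  fixes \<phi> :: "real \<Rightarrow> real" and c :: "nat \<Rightarrow> real" and N :: nat
  assumes "0 < e" "e \<le> t" "continuous_on {e..t} \<phi>" "\<And>n. 0 \<le> c n" "c 0 = 1"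
  defines "V \<equiv> \<lambda>a. integral {a..t} (\<lambda>b. (\<Sum>n<Suc N. c n * (a / b) ^ n) * \<phi> b)"
  shows "continuous_on {e..t} V"
    and "(integral {e..t} \<phi>)\<^sup>2 \<le> 2 * integral {e..t} (\<lambda>a. \<phi> a * V a)"
proof -
  define W where "W n a = integral {a..t} (\<lambda>b. \<phi> b / b ^ n)" for n a
  note W = weighted_square_le_integral[OF assms(1-3), folded W_def]
  have V: "V a = (\<Sum>n<Suc N. c n * a ^ n * W n a)" if "a \<in> {e..t}" for a
  proof -
    have "(\<lambda>b. \<phi> b / b ^ n) integrable_on {a..t}" for n
      using that assms(1)
      by (intro integrable_continuous_real continuous_intros continuous_on_subset[OF assms(3)]) auto
    then have "((\<lambda>b. \<Sum>n<Suc N. c n * a ^ n * (\<phi> b / b ^ n)) has_integral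
        (\<Sum>n<Suc N. c n * a ^ n * W n a)) {a..t}"
      unfolding W_def by (intro has_integral_sum has_integral_mult_right integrable_integral) auto
    also have "(\<lambda>b. \<Sum>n<Suc N. c n * a ^ n * (\<phi> b / b ^ n)) =
        (\<lambda>b. (\<Sum>n<Suc N. c n * (a / b) ^ n) * \<phi> b)"
      by (simp only: sum_distrib_right power_divide) (simp add: mult_ac)
    finally show ?thesis
      unfolding V_def by (rule integral_unique)
  qed
  have "continuous_on {e..t} (\<lambda>a. \<Sum>n<Suc N. c n * a ^ n * W n a)"
    by (intro continuous_intros W)
  then show "continuous_on {e..t} V"
    by (rule continuous_on_eq) (use V in simp)
  have int: "(\<lambda>a. a ^ n * \<phi> a * W n a) integrable_on {e..t}" for n
    by (intro integrable_continuous_real continuous_intros assms(3) W)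
  have nonneg: "0 \<le> integral {e..t} (\<lambda>a. a ^ n * \<phi> a * W n a)" for n
  proof -
    have "0 \<le> e ^ (2 * n) * (W n e)\<^sup>2" using assms(1) by simp
    then show ?thesis using W(2)[of n] by linarith
  qed
  have "((\<lambda>a. \<Sum>n<Suc N. c n * (a ^ n * \<phi> a * W n a)) has_integral
      (\<Sum>n<Suc N. c n * integral {e..t} (\<lambda>a. a ^ n * \<phi> a * W n a))) {e..t}"
    using int by (intro has_integral_sum has_integral_mult_right integrable_integral) auto
  then have "((\<lambda>a. \<phi> a * V a) has_integral
      (\<Sum>n<Suc N. c n * integral {e..t} (\<lambda>a. a ^ n * \<phi> a * W n a))) {e..t}"
    by (rule has_integral_eq[rotated])
       (simp add: V sum_distrib_left distrib_left mult_ac del: sum.lessThan_Suc)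
  then have "integral {e..t} (\<lambda>a. \<phi> a * V a) =
      (\<Sum>n<Suc N. c n * integral {e..t} (\<lambda>a. a ^ n * \<phi> a * W n a))"
    by (rule integral_unique)
  \<comment> \<open>Discard all terms but \<open>n = 0\<close>.\<close>
  also have "\<dots> \<ge> (\<Sum>n\<in>{0}. c n * integral {e..t} (\<lambda>a. a ^ n * \<phi> a * W n a))"
    by (rule sum_mono2) (auto intro!: mult_nonneg_nonneg nonneg assms(4))
  finally have "integral {e..t} (\<lambda>a. \<phi> a * W 0 a) \<le> integral {e..t} (\<lambda>a. \<phi> a * V a)"
    using assms(5) by simp
  then show "(integral {e..t} \<phi>)\<^sup>2 \<le> 2 * integral {e..t} (\<lambda>a. \<phi> a * V a)"
    using W(2)[of 0] by (simp add: W_def)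
qed

section \<open>From the binomial series to the square inequality\<close>

text \<open>In the binomial series at \<open>- r\<close> the sign of \<open>(- r) ^ n\<close>
  cancels that of the generalized binomial coefficient. What remains is a rising factorial of
  \<open>1 - \<alpha> > 0\<close>, hence nonnegative.\<close>

lemma binomial_series_coeffs:
  fixes \<alpha> :: real
  assumes "\<alpha> < 1"
  defines "c \<equiv> \<lambda>n. pochhammer (1 - \<alpha>) n / fact n"
  shows "0 \<le> c n" "c 0 = 1"
    and "0 \<le> r \<Longrightarrow> r < 1 \<Longrightarrow> (\<lambda>n. c n * r ^ n) sums (1 - r) powr (\<alpha> - 1)"
proof -
  show "0 \<le> c n" using assms(1) by (simp add: c_def pochhammer_nonneg)
  show "c 0 = 1" by (simp add: c_def)
  assume "0 \<le> r" "r < 1"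
  moreover have "(\<alpha> - 1 gchoose n) * (- r) ^ n = c n * r ^ n" for n
  proof -
    have "(- 1) ^ n * (- 1) ^ n * x = x" for x :: real
      by simp
    then show ?thesis
      unfolding gbinomial_pochhammer c_def power_minus[of r n] by (simp add: mult_ac)
  qed
  ultimately show "(\<lambda>n. c n * r ^ n) sums (1 - r) powr (\<alpha> - 1)"
    using gen_binomial_real[of "- r" "\<alpha> - 1"] by (simp only: abs_minus_cancel abs_of_nonneg) simp
qed

text \<open>With time measured backwards from \<open>t\<close>, the fractional integral at
  \<open>t - a\<close> runs over \<open>b\<close> from \<open>a\<close> to \<open>t\<close>, with
  its singularity at \<open>b = a\<close>.\<close>

lemma RL_integral_reflect:
  fixes g :: "real \<Rightarrow> real"
  assumes "0 < \<alpha>"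
  shows "Gamma \<alpha> * RL_integral \<alpha> g (t - a) = (LINT b:{a..t}|lborel. (b - a) powr (\<alpha> - 1) * g (t - b))"
proof -
  have "Gamma \<alpha> \<noteq> 0" using Gamma_real_pos[OF assms] by linarith
  then show ?thesis
    using set_integral_Icc_minus[of a t "\<lambda>b. (b - a) powr (\<alpha> - 1) * g (t - b)" t]
    by (simp add: RL_integral_def diff_diff_eq add.commute)
qed

text \<open>The partial sums \<open>p N\<close> increase to the singular kernel, and the inequality
  holds for each of them. Dominated convergence is applied twice: in \<open>b\<close> for the inner
  integral \<open>V N a\<close>, then in \<open>a\<close> for the outer one.\<close>

lemma RL_integral_square_le_truncated:
  fixes g :: "real \<Rightarrow> real"
  assumes "0 < \<alpha>" "\<alpha> < 1" "0 < e" "e \<le> t" "continuous_on {0..t} g"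
  defines "\<phi> \<equiv> \<lambda>a. a powr (\<alpha> - 1) * g (t - a)"
  shows "(LINT a:{e..t}|lborel. \<phi> a)\<^sup>2
    \<le> 2 * (LINT a:{e..t}|lborel. \<phi> a * (Gamma \<alpha> * RL_integral \<alpha> g (t - a)))"
proof -
  define c where "c n = pochhammer (1 - \<alpha>) n / fact n" for n
  note c = binomial_series_coeffs[OF assms(2), folded c_def]
  define p where "p N r = (\<Sum>n<Suc N. c n * r ^ n)" for N r
  have p: "0 \<le> p N r" "p N r \<le> (1 - r) powr (\<alpha> - 1)" "(\<lambda>N. p N r) \<longlonglongrightarrow> (1 - r) powr (\<alpha> - 1)"
    if "0 \<le> r" "r < 1" for N r
  proof -
    show "0 \<le> p N r" unfolding p_def using c(1) that(1) by (intro sum_nonneg) auto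
    show "p N r \<le> (1 - r) powr (\<alpha> - 1)"
      using sum_le_suminf[OF sums_summable[OF c(3)[OF that]], of "{..<Suc N}"] c(1) that
        sums_unique[OF c(3)[OF that]] by (simp add: p_def)
    show "(\<lambda>N. p N r) \<longlonglongrightarrow> (1 - r) powr (\<alpha> - 1)"
      using LIMSEQ_Suc[OF c(3)[OF that, unfolded sums_def]] by (simp only: p_def)
  qed
  obtain M where M: "0 \<le> M" "\<And>s. s \<in> {0..t} \<Longrightarrow> norm (g s) \<le> M"
    using bounded_on_Icc[OF assms(5)] by blast
  have g: "continuous_on {e..t} (\<lambda>b. g (t - b))"
    using assms(3) by (intro continuous_on_compose2[OF assms(5)] continuous_intros) auto
  have \<phi>: "continuous_on {e..t} \<phi>"
    unfolding \<phi>_def using assms(3) by (intro continuous_intros g) auto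
  define V where "V N a = (LINT b:{a..t}|lborel. p N (a / b) * \<phi> b)" for N a
  have p_cont: "continuous_on {a..t} (\<lambda>b. p N (a / b) * \<phi> b)" if "a \<in> {e..t}" for N a
    unfolding p_def using that assms(3)
    by (intro continuous_intros continuous_on_subset[OF \<phi>]) auto
  have V_eq: "V N a = integral {a..t} (\<lambda>b. (\<Sum>n<Suc N. c n * (a / b) ^ n) * \<phi> b)"
    if "a \<in> {e..t}" for N a
    unfolding V_def p_def[symmetric]
    by (rule set_borel_integral_eq_integral(2)[OF borel_integrable_atLeastAtMost'[OF p_cont[OF that]]])
  have V_cont: "continuous_on {e..t} (V N)" for N
    by (rule continuous_on_eq[OF integral_square_le_power_series_kernel(1)[where c = c, OF assms(3,4) \<phi> c(1,2)]])
       (use V_eq in simp)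
  have le: "(LINT a:{e..t}|lborel. \<phi> a)\<^sup>2 \<le> 2 * (LINT a:{e..t}|lborel. \<phi> a * V N a)" for N
  proof -
    have "(LINT a:{e..t}|lborel. \<phi> a) = integral {e..t} \<phi>"
      by (rule set_borel_integral_eq_integral(2)[OF borel_integrable_atLeastAtMost'[OF \<phi>]])
    moreover have "(LINT a:{e..t}|lborel. \<phi> a * V N a) = integral {e..t} (\<lambda>a. \<phi> a * V N a)"
      by (intro set_borel_integral_eq_integral(2) borel_integrable_atLeastAtMost' continuous_intros \<phi> V_cont)
    moreover have "integral {e..t} (\<lambda>a. \<phi> a * V N a) = integral {e..t}
        (\<lambda>a. \<phi> a * integral {a..t} (\<lambda>b. (\<Sum>n<Suc N. c n * (a / b) ^ n) * \<phi> b))"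
      by (intro integral_cong) (simp only: V_eq)
    ultimately show ?thesis
      using integral_square_le_power_series_kernel(2)[where c = c, OF assms(3,4) \<phi> c(1,2)] by simp
  qed
  \<comment> \<open>The limit kernel times the weight \<open>b powr (\<alpha> - 1)\<close> inside
    \<open>\<phi> b\<close> is the fractional kernel. At \<open>a = b\<close> both sides are 0,
    since \<open>0 powr (\<alpha> - 1) = 0\<close>.\<close>
  have kernel: "(1 - a / b) powr (\<alpha> - 1) * \<phi> b = (b - a) powr (\<alpha> - 1) * g (t - b)"
    if "e \<le> a" "a \<le> b" for a b
  proof -
    have "(1 - a / b) * b = b - a" using that assms(3) by (simp add: field_simps)
    then have "(1 - a / b) powr (\<alpha> - 1) * b powr (\<alpha> - 1) = (b - a) powr (\<alpha> - 1)"
      using that assms(3) powr_mult[of "1 - a / b" b "\<alpha> - 1"] by simp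
    then show ?thesis by (simp add: \<phi>_def flip: mult.assoc)
  qed
  \<comment> \<open>An integrable majorant of the inner integrands, independent of
    \<open>N\<close>.\<close>
  define K where "K a = (\<lambda>b. M * (b - a) powr (\<alpha> - 1))" for a
  have K_int: "set_integrable lborel {a..t} (K a)" for a
    using set_integrable_powr[OF assms(1), of "t - a"]
      set_integrable_Icc_minus[of a t "\<lambda>b. (b - a) powr (\<alpha> - 1)" t]
      RL_kernel_integrable[OF assms(1), of "t - a"]
    by (simp add: K_def diff_diff_eq add.commute)
  have bound: "norm (p N (a / b) * \<phi> b) \<le> K a b" if "e \<le> a" "a < b" "b \<le> t" for N a b
  proof -
    have "norm (p N (a / b) * \<phi> b) \<le> norm ((1 - a / b) powr (\<alpha> - 1) * \<phi> b)"
      unfolding norm_mult using p(1,2)[of "a / b" N] that assms(3)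
      by (intro mult_right_mono) auto
    also have "\<dots> \<le> K a b"
      using M(2)[of "t - b"] that assms(3)
      by (subst kernel) (auto simp: K_def abs_mult mult.commute[of M] intro!: mult_left_mono)
    finally show ?thesis .
  qed
  \<comment> \<open>At \<open>b = a\<close> the ratio \<open>a / b\<close> is 1, outside the range
    of the series expansion; this null set is excluded.\<close>
  have AE_ne: "AE b in lborel. b \<noteq> a" for a :: real
    by (rule AE_lborel_singleton)
  have V_lim: "(\<lambda>N. V N a) \<longlonglongrightarrow> Gamma \<alpha> * RL_integral \<alpha> g (t - a)" if a: "a \<in> {e..t}" for a
    unfolding V_def RL_integral_reflect[OF assms(1)]
  proof (rule set_integral_dominated_convergence[OF _ _ K_int])
    show "set_borel_measurable lborel {a..t} (\<lambda>b. p N (a / b) * \<phi> b)" for N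
      using borel_integrable_atLeastAtMost'[OF p_cont[OF a]]
      by (auto simp: set_borel_measurable_def set_integrable_def)
    show "set_borel_measurable lborel {a..t} (\<lambda>b. (b - a) powr (\<alpha> - 1) * g (t - b))"
      using set_borel_measurable_scaleR[of "\<lambda>b. (b - a) powr (\<alpha> - 1)" "{a..t}" "\<lambda>b. g (t - b)"]
        borel_measurable_continuous_on_indicator[OF _ continuous_on_subset[OF g, of "{a..t}"]] a
      by (auto simp: set_borel_measurable_def)
    show "AE b in lborel. b \<in> {a..t} \<longrightarrow>
        (\<lambda>N. p N (a / b) * \<phi> b) \<longlonglongrightarrow> (b - a) powr (\<alpha> - 1) * g (t - b)"
      using AE_ne[of a]
    proof eventually_elim
      case (elim b)
      show ?case
      proof
        assume "b \<in> {a..t}"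
        then show "(\<lambda>N. p N (a / b) * \<phi> b) \<longlonglongrightarrow> (b - a) powr (\<alpha> - 1) * g (t - b)"
          using a elim assms(3) by (subst kernel[symmetric]) (auto intro!: tendsto_mult p(3))
      qed
    qed
    show "AE b in lborel. b \<in> {a..t} \<longrightarrow> norm (p N (a / b) * \<phi> b) \<le> K a b" for N
      using AE_ne[of a] by eventually_elim (use bound a in auto)
  qed
  \<comment> \<open>A bound on all \<open>V N a\<close>, uniform in both \<open>N\<close> and
    \<open>a\<close>, for the outer limit.\<close>
  define B where "B = (LINT u:{0..t}|lborel. M * u powr (\<alpha> - 1))"
  have V_le: "norm (V N a) \<le> B" if a: "a \<in> {e..t}" for N a
  proof -
    have V_int: "set_integrable lborel {a..t} (\<lambda>b. p N (a / b) * \<phi> b)"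
      by (rule borel_integrable_atLeastAtMost'[OF p_cont[OF a]])
    then have "norm (V N a) \<le> (LINT b:{a..t}|lborel. norm (p N (a / b) * \<phi> b))"
      unfolding V_def by (rule set_integral_norm_bound)
    also have "\<dots> \<le> (LINT b:{a..t}|lborel. K a b)"
      unfolding set_lebesgue_integral_def
    proof (rule integral_mono_AE)
      show "AE b in lborel. indicat_real {a..t} b *\<^sub>R norm (p N (a / b) * \<phi> b)
          \<le> indicat_real {a..t} b *\<^sub>R K a b"
        using AE_ne[of a]
        by eventually_elim (use bound a in \<open>auto split: split_indicator\<close>)
    qed (use set_integrable_norm[OF V_int] K_int in \<open>auto simp: set_integrable_def\<close>)
    also have "\<dots> = (LINT u:{0..t - a}|lborel. M * u powr (\<alpha> - 1))"
      using set_integral_Icc_minus[of 0 "t - a" "\<lambda>u. M * (t - a - u) powr (\<alpha> - 1)" "t - a"]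
        set_integral_Icc_minus[of a t "K a" t] by (auto simp: K_def diff_diff_eq add.commute)
    also have "\<dots> \<le> B"
      unfolding B_def set_lebesgue_integral_def
    proof (rule integral_mono)
      show "indicat_real {0..t - a} u *\<^sub>R (M * u powr (\<alpha> - 1))
          \<le> indicat_real {0..t} u *\<^sub>R (M * u powr (\<alpha> - 1))" for u
        using M(1) a assms(3) by (auto split: split_indicator)
    qed (use set_integrable_powr[OF assms(1)] in \<open>auto simp: set_integrable_def mult.left_commute\<close>)
    finally show ?thesis .
  qed
  have "(\<lambda>N. LINT a:{e..t}|lborel. \<phi> a * V N a) \<longlonglongrightarrow>
      (LINT a:{e..t}|lborel. \<phi> a * (Gamma \<alpha> * RL_integral \<alpha> g (t - a)))"
  proof (rule set_integral_dominated_convergence)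
    have "continuous_on {e..t} (\<lambda>a. RL_integral \<alpha> g (t - a))"
      using assms(3)
      by (intro continuous_on_compose2[OF continuous_on_RL_integral[OF assms(1,5)]] continuous_intros) auto
    then have "continuous_on {e..t} (\<lambda>a. \<phi> a * (Gamma \<alpha> * RL_integral \<alpha> g (t - a)))"
      by (intro continuous_intros \<phi>)
    from borel_integrable_atLeastAtMost'[OF this]
    show "set_borel_measurable lborel {e..t} (\<lambda>a. \<phi> a * (Gamma \<alpha> * RL_integral \<alpha> g (t - a)))"
      by (auto simp: set_borel_measurable_def set_integrable_def)
    have "continuous_on {e..t} (\<lambda>a. \<phi> a * V N a)" for N
      by (intro continuous_intros \<phi> V_cont)
    from borel_integrable_atLeastAtMost'[OF this]
    show "set_borel_measurable lborel {e..t} (\<lambda>a. \<phi> a * V N a)" for N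
      by (auto simp: set_borel_measurable_def set_integrable_def)
    show "set_integrable lborel {e..t} (\<lambda>a. \<bar>\<phi> a\<bar> * B)"
      by (intro borel_integrable_atLeastAtMost' continuous_intros \<phi>)
    show "AE a in lborel. a \<in> {e..t} \<longrightarrow> norm (\<phi> a * V N a) \<le> \<bar>\<phi> a\<bar> * B" for N
      using V_le by (intro AE_I2) (auto simp: abs_mult intro!: mult_left_mono)
    show "AE a in lborel. a \<in> {e..t} \<longrightarrow>
        (\<lambda>N. \<phi> a * V N a) \<longlonglongrightarrow> \<phi> a * (Gamma \<alpha> * RL_integral \<alpha> g (t - a))"
      by (intro AE_I2 impI tendsto_mult tendsto_const V_lim)
  qed
  then have "(\<lambda>N. 2 * (LINT a:{e..t}|lborel. \<phi> a * V N a)) \<longlonglongrightarrow>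
      2 * (LINT a:{e..t}|lborel. \<phi> a * (Gamma \<alpha> * RL_integral \<alpha> g (t - a)))"
    by (intro tendsto_mult tendsto_const)
  then show ?thesis
    by (rule LIMSEQ_le_const) (use le in auto)
qed

text \<open>The truncated inequality is taken at \<open>e = t / (n + 1)\<close> and \<open>n\<close>
  tends to infinity; both reflected integrands are integrable up to 0, so both sides
  converge.\<close>

lemma RL_integral_square_le:
  fixes g :: "real \<Rightarrow> real"
  assumes "0 < \<alpha>" "\<alpha> < 1" "0 \<le> t" "continuous_on {0..t} g"
  shows "(RL_integral \<alpha> g t)\<^sup>2 \<le> 2 * RL_integral \<alpha> (\<lambda>s. g s * RL_integral \<alpha> g s) t"
proof (cases "t = 0")
  case True
  then show ?thesis by (simp add: RL_integral_rescale[OF assms(1)])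
next
  case False
  then have t: "0 < t" using assms(3) by simp
  define J where "J = RL_integral \<alpha> g"
  define \<phi> where "\<phi> a = a powr (\<alpha> - 1) * g (t - a)" for a
  define \<psi> where "\<psi> a = \<phi> a * (Gamma \<alpha> * J (t - a))" for a
  have G: "Gamma \<alpha> > 0" using Gamma_real_pos[OF assms(1)] .
  have J: "continuous_on {0..t} J"
    unfolding J_def by (rule continuous_on_RL_integral[OF assms(1,4)])
  have J_eq: "Gamma \<alpha> * RL_integral \<alpha> g t = (LINT a:{0..t}|lborel. \<phi> a)"
    using RL_integral_reflect[OF assms(1), of g t 0] by (simp add: \<phi>_def)
  have JJ_eq: "Gamma \<alpha> * RL_integral \<alpha> (\<lambda>s. g s * J s) t * Gamma \<alpha> = (LINT a:{0..t}|lborel. \<psi> a)"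
  proof -
    have "\<psi> = (\<lambda>a. a powr (\<alpha> - 1) * (g (t - a) * J (t - a)) * Gamma \<alpha>)"
      by (simp add: \<psi>_def \<phi>_def fun_eq_iff)
    then show ?thesis
      using RL_integral_reflect[OF assms(1), of "\<lambda>s. g s * J s" t 0]
      by (simp only: set_integral_mult_left diff_zero)
  qed
  have int: "set_integrable lborel {0..t} (\<lambda>a. a powr (\<alpha> - 1) *\<^sub>R f (t - a))"
    if "continuous_on {0..t} f" for f :: "real \<Rightarrow> real"
    by (intro set_integrable_scaleR_continuous set_integrable_powr assms(1)
          continuous_on_compose2[OF that] continuous_intros) auto
  have \<phi>: "set_integrable lborel {0..t} \<phi>"
    unfolding \<phi>_def using int[OF assms(4)] by simp
  have "\<psi> = (\<lambda>a. a powr (\<alpha> - 1) *\<^sub>R (g (t - a) * (Gamma \<alpha> * J (t - a))))"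
    by (simp add: \<psi>_def \<phi>_def mult.assoc fun_eq_iff)
  then have \<psi>: "set_integrable lborel {0..t} \<psi>"
    using int[of "\<lambda>a. g a * (Gamma \<alpha> * J a)"] assms(4) J by (simp only: continuous_intros)
  \<comment> \<open>\<open>Suc n\<close> avoids division by 0 and keeps the left endpoint at most
    \<open>t\<close>. The sets increase to \<open>{0<..t}\<close>; the missing point 0 is harmless,
    as \<open>\<phi>\<close> and \<open>\<psi>\<close> vanish there.\<close>
  define A where "A n = {t / real (Suc n)..t}" for n
  have A: "(\<Union>n. A n) = {0<..t}"
  proof (intro equalityI subsetI)
    fix a assume a: "a \<in> {0<..t}"
    then obtain n where "t / a < real n" using reals_Archimedean2 by blast
    then have "t < real n * a" using a by (simp add: divide_less_eq)
    then have "t / real (Suc n) \<le> a" using a by (simp add: divide_le_eq distrib_left mult.commute)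
    then show "a \<in> (\<Union>n. A n)" using a by (auto simp: A_def)
  next
    fix a assume "a \<in> (\<Union>n. A n)"
    then obtain n where "t / real (Suc n) \<le> a" "a \<le> t" by (auto simp: A_def)
    moreover have "0 < t / real (Suc n)" using t by simp
    ultimately show "a \<in> {0<..t}" by simp
  qed
  have lim: "(\<lambda>n. LINT a:A n|lborel. f a) \<longlonglongrightarrow> (LINT a:{0..t}|lborel. f a)"
    if "set_integrable lborel {0..t} f" "f 0 = 0" for f :: "real \<Rightarrow> real"
  proof -
    have "(\<lambda>n. LINT a:A n|lborel. f a) \<longlonglongrightarrow> (LINT a:(\<Union>n. A n)|lborel. f a)"
    proof (rule set_integral_cont_up)
      show "incseq A"
        unfolding A_def using assms(3)
        by (intro monoI) (auto intro!: divide_left_mono)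
      show "set_integrable lborel (\<Union>n. A n) f"
        unfolding A by (rule set_integrable_subset[OF that(1)]) auto
    qed (auto simp: A_def)
    also have "(LINT a:(\<Union>n. A n)|lborel. f a) = (LINT a:{0..t}|lborel. f a)"
      unfolding set_lebesgue_integral_def A using that(2)
      by (intro Bochner_Integration.integral_cong) (auto split: split_indicator simp: order_le_less)
    finally show ?thesis .
  qed
  have le: "(LINT a:A n|lborel. \<phi> a)\<^sup>2 \<le> 2 * (LINT a:A n|lborel. \<psi> a)" for n
    unfolding A_def \<psi>_def \<phi>_def J_def
    by (rule RL_integral_square_le_truncated[OF assms(1,2) _ _ assms(4)]) (use t in \<open>auto simp: field_simps\<close>)
  have lim_\<phi>: "(\<lambda>n. (LINT a:A n|lborel. \<phi> a)\<^sup>2) \<longlonglongrightarrow> (LINT a:{0..t}|lborel. \<phi> a)\<^sup>2"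
    by (intro tendsto_power lim \<phi>) (simp add: \<phi>_def)
  have lim_\<psi>: "(\<lambda>n. 2 * (LINT a:A n|lborel. \<psi> a)) \<longlonglongrightarrow> 2 * (LINT a:{0..t}|lborel. \<psi> a)"
    by (intro tendsto_mult tendsto_const lim \<psi>) (simp add: \<psi>_def \<phi>_def)
  have "(LINT a:{0..t}|lborel. \<phi> a)\<^sup>2 \<le> 2 * (LINT a:{0..t}|lborel. \<psi> a)"
    by (rule LIMSEQ_le[OF lim_\<phi> lim_\<psi>]) (use le in auto)
  then have "(Gamma \<alpha>)\<^sup>2 * (J t)\<^sup>2 \<le> (Gamma \<alpha>)\<^sup>2 * (2 * RL_integral \<alpha> (\<lambda>s. g s * J s) t)"
    unfolding J_eq[symmetric] JJ_eq[symmetric] J_def[symmetric] by (simp add: power2_eq_square mult_ac)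
  then show ?thesis
    using G by (simp add: J_def)
qed

section \<open>The energy bound and the Maxwell-Bloch system\<close>

lemma RL_integral_mult_left:
  fixes f :: "real \<Rightarrow> real"
  shows "RL_integral \<alpha> (\<lambda>s. c * f s) t = c * RL_integral \<alpha> f t"
proof -
  have "(\<lambda>s. (t - s) powr (\<alpha> - 1) * (c * f s)) = (\<lambda>s. c * ((t - s) powr (\<alpha> - 1) * f s))"
    by (auto simp: mult_ac)
  then show ?thesis by (simp add: RL_integral_def)
qed

lemma RL_integral_sum:
  fixes f :: "'i \<Rightarrow> real \<Rightarrow> real"
  assumes "0 < \<alpha>" "\<And>i. i \<in> I \<Longrightarrow> continuous_on {0..t} (f i)"
  shows "RL_integral \<alpha> (\<lambda>s. \<Sum>i\<in>I. f i s) t = (\<Sum>i\<in>I. RL_integral \<alpha> (f i) t)"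
proof -
  have "(LINT s:{0..t}|lborel. \<Sum>i\<in>I. (t - s) powr (\<alpha> - 1) * f i s) =
      (\<Sum>i\<in>I. LINT s:{0..t}|lborel. (t - s) powr (\<alpha> - 1) * f i s)"
    unfolding set_lebesgue_integral_def scaleR_sum_right
    using RL_integrable[OF assms] by (intro Bochner_Integration.integral_sum) (simp add: set_integrable_def)
  then show ?thesis
    by (simp add: RL_integral_def sum_distrib_left sum_divide_distrib)
qed

text \<open>With \<open>u = c + J\<close>, the energy changes by the sum of
  \<open>(J i t)\<^sup>2 + 2 * c i * J i t\<close>. The square inequality bounds the first part by
  twice the fractional integral of the sum of \<open>g i * J i\<close>. Orthogonality replaces that
  sum by the sum of \<open>- c i * g i\<close>, whose integral cancels the second part.\<close>

lemma volterra_energy: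
  fixes g u :: "'i \<Rightarrow> real \<Rightarrow> real"
  assumes "0 < \<alpha>" "\<alpha> < 1" "0 \<le> t"
    and g: "\<And>i. i \<in> I \<Longrightarrow> continuous_on {0..t} (g i)"
    and u: "\<And>i s. i \<in> I \<Longrightarrow> s \<in> {0..t} \<Longrightarrow> u i s = c i + RL_integral \<alpha> (g i) s"
    and orth: "\<And>s. s \<in> {0..t} \<Longrightarrow> (\<Sum>i\<in>I. u i s * g i s) = 0"
  shows "(\<Sum>i\<in>I. (u i t)\<^sup>2) \<le> (\<Sum>i\<in>I. (c i)\<^sup>2)"
proof -
  define J where "J i = RL_integral \<alpha> (g i)" for i
  have J: "continuous_on {0..t} (J i)" if "i \<in> I" for i
    unfolding J_def by (rule continuous_on_RL_integral[OF assms(1) g[OF that]])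
  have "(\<Sum>i\<in>I. (J i t)\<^sup>2) \<le> (\<Sum>i\<in>I. 2 * RL_integral \<alpha> (\<lambda>s. g i s * J i s) t)"
    unfolding J_def by (intro sum_mono RL_integral_square_le assms(1-3) g)
  also have "\<dots> = 2 * RL_integral \<alpha> (\<lambda>s. \<Sum>i\<in>I. g i s * J i s) t"
    by (subst RL_integral_sum[OF assms(1)]) (auto simp: sum_distrib_left intro!: continuous_intros g J)
  also have "RL_integral \<alpha> (\<lambda>s. \<Sum>i\<in>I. g i s * J i s) t = RL_integral \<alpha> (\<lambda>s. \<Sum>i\<in>I. - c i * g i s) t"
  proof (rule RL_integral_cong)
    fix s assume s: "s \<in> {0..t}"
    have "0 = (\<Sum>i\<in>I. (c i + J i s) * g i s)"
      using orth[OF s] u[OF _ s] by (simp add: J_def)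
    also have "\<dots> = (\<Sum>i\<in>I. g i s * J i s) - (\<Sum>i\<in>I. - c i * g i s)"
      by (simp add: algebra_simps sum.distrib sum_negf)
    finally show "(\<Sum>i\<in>I. g i s * J i s) = (\<Sum>i\<in>I. - c i * g i s)" by simp
  qed
  also have "\<dots> = (\<Sum>i\<in>I. - c i * J i t)"
    unfolding J_def
    by (rule trans[OF RL_integral_sum[OF assms(1)]])
       (simp_all only: RL_integral_mult_left continuous_on_mult_const continuous_on_mult_left g)
  finally have "(\<Sum>i\<in>I. (J i t)\<^sup>2) + 2 * (\<Sum>i\<in>I. c i * J i t) \<le> 0"
    by (simp add: sum_negf)
  moreover have "(\<Sum>i\<in>I. (u i t)\<^sup>2) =
      (\<Sum>i\<in>I. (c i)\<^sup>2) + ((\<Sum>i\<in>I. (J i t)\<^sup>2) + 2 * (\<Sum>i\<in>I. c i * J i t))"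
    using u[of _ t] assms(3)
    by (simp add: J_def power2_sum sum.distrib sum_distrib_left algebra_simps)
  ultimately show ?thesis by linarith
qed

section \<open>Truncation and local Lipschitz continuity of the field\<close>

text \<open>Inside the ball the factor is 1, outside it is \<open>R / norm x\<close>. The radial
  form preserves orthogonality relations of the field, and \<open>c \<le> 1\<close> preserves bounds
  on components.\<close>

lemma closest_point_cball_0:
  fixes x :: "'a::euclidean_space"
  assumes "0 \<le> R"
  obtains c where "0 \<le> c" "c \<le> 1" "closest_point (cball 0 R) x = c *\<^sub>R x"
proof (cases "norm x \<le> R")
  case True
  then show ?thesis
    by (intro that[of 1]) (auto simp: closest_point_self)
next
  case False
  then have x: "R < norm x" "norm x > 0" using assms by auto
  have "(R / norm x) *\<^sub>R x = closest_point (cball 0 R) x"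
  proof (rule closest_point_unique)
    have "dist x ((R / norm x) *\<^sub>R x) = norm ((1 - R / norm x) *\<^sub>R x)"
      by (simp add: dist_norm scaleR_diff_left)
    also have "\<dots> = norm x - R"
      using x assms by (simp add: abs_of_nonneg left_diff_distrib)
    finally have "dist x ((R / norm x) *\<^sub>R x) = norm x - R" .
    \<comment> \<open>By the reverse triangle inequality no point of the ball is closer than
      \<open>norm x - R\<close>.\<close>
    moreover have "norm x - norm z \<le> dist x z" for z
      unfolding dist_norm by (rule norm_triangle_ineq2)
    ultimately show "\<forall>z\<in>cball 0 R. dist x ((R / norm x) *\<^sub>R x) \<le> dist x z"
      by (force intro: order_trans[rotated])
  qed (use x assms in auto)
  then show ?thesis
    using x assms by (intro that[of "R / norm x"]) auto
qed

text \<open>The field is linear plus products of a coordinate with a linear map. Changing one factor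
  of a product at a time, with the other bounded in terms of \<open>R\<close>, gives the constant
  \<open>2 * R * K B\<close>.\<close>

lemma MB_field_lipschitz_on_cball:
  assumes "0 \<le> R"
  obtains L where "L-lipschitz_on (cball 0 R) MB_field"
proof -
  have "\<exists>K>0. \<forall>x. norm (B *v x) \<le> norm x * K" for B :: "real^5^5"
    using bounded_linear.pos_bounded[OF matrix_vector_mul_bounded_linear[of B]] by blast
  then obtain K :: "real^5^5 \<Rightarrow> real" where K: "K B > 0" "norm (B *v x) \<le> norm x * K B" for B x
    by metis
  let ?L = "K MB_A + 2 * R * K MB_A1 + 2 * R * K MB_A2"
  have "dist (MB_field x) (MB_field y) \<le> ?L * dist x y" if "norm x \<le> R" "norm y \<le> R" for x y
  proof -
    have q: "norm ((x $ i) *\<^sub>R (B *v x) - (y $ i) *\<^sub>R (B *v y)) \<le> 2 * R * K B * norm (x - y)" for i B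
    proof -
      have "(x $ i) *\<^sub>R (B *v x) - (y $ i) *\<^sub>R (B *v y) = (x $ i) *\<^sub>R (B *v (x - y)) + ((x - y) $ i) *\<^sub>R (B *v y)"
        by (simp add: matrix_vector_mult_diff_distrib algebra_simps)
      also have "norm \<dots> \<le> \<bar>x $ i\<bar> * norm (B *v (x - y)) + \<bar>(x - y) $ i\<bar> * norm (B *v y)"
        by (metis norm_triangle_ineq norm_scaleR)
      also have "\<dots> \<le> R * (norm (x - y) * K B) + norm (x - y) * (R * K B)"
      proof (intro add_mono mult_mono)
        show "\<bar>x $ i\<bar> \<le> R" using component_le_norm_cart[of x i] that by simp
        show "\<bar>(x - y) $ i\<bar> \<le> norm (x - y)" by (rule component_le_norm_cart)
        show "norm (B *v y) \<le> R * K B"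
          using K(1)[of B] by (intro order_trans[OF K(2)] mult_right_mono that) simp
      qed (use K assms in auto)
      finally show ?thesis by (simp add: mult_ac)
    qed
    have "MB_field x - MB_field y = MB_A *v (x - y) + ((x $ 1) *\<^sub>R (MB_A1 *v x) - (y $ 1) *\<^sub>R (MB_A1 *v y))
        + ((x $ 2) *\<^sub>R (MB_A2 *v x) - (y $ 2) *\<^sub>R (MB_A2 *v y))"
      by (simp add: MB_field_def matrix_vector_mult_diff_distrib)
    also have "norm \<dots> \<le> norm (x - y) * K MB_A + 2 * R * K MB_A1 * norm (x - y)
        + 2 * R * K MB_A2 * norm (x - y)"
      by (intro norm_triangle_mono q K)
    finally show ?thesis by (simp add: dist_norm algebra_simps)
  qed
  then have "?L-lipschitz_on (cball 0 R) MB_field"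
    using assms K(1)[THEN less_imp_le] by (intro lipschitz_onI) auto
  then show ?thesis by (rule that)
qed

theorem proposition3p1:
  fixes \<alpha> \<tau> :: real and x0 :: "real^5"
  assumes "0 < \<alpha>" and "\<alpha> < 1" and "0 < \<tau>"
  shows "\<exists>x. caputo_ivp_solution \<alpha> MB_field x0 \<tau> x \<and>
             (\<forall>y. caputo_ivp_solution \<alpha> MB_field x0 \<tau> y \<longrightarrow> (\<forall>t\<in>{0..<\<tau>}. y t = x t))"
proof -
  \<comment> \<open>The components 3, 4, 5 carry the energy: on them the state is orthogonal to the
    field.\<close>
  define I where "I = {3, 4, 5 :: 5}"
  define \<rho> where "\<rho> = sqrt (\<Sum>i\<in>I. (x0 $ i)\<^sup>2)"
  define \<kappa> where "\<kappa> = exp_kernel \<alpha> 0 \<tau>"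
  \<comment> \<open>The sum of the a priori bounds on the five components: \<open>\<rho>\<close> for
    each of 3, 4, 5, and the initial size plus \<open>\<rho> * \<kappa>\<close> for 1 and 2. Here
    \<open>\<kappa>\<close> bounds the fractional integral of the constant 1 on
    \<open>{0..\<tau>}\<close>.\<close>
  define R where "R = \<bar>x0 $ 1\<bar> + \<bar>x0 $ 2\<bar> + 2 * \<rho> * \<kappa> + 3 * \<rho>"
  have nonneg: "0 \<le> \<rho>" "0 \<le> \<kappa>" "0 \<le> R"
    unfolding \<rho>_def \<kappa>_def R_def using exp_kernel_nonneg[OF assms(1)] by (auto simp: sum_nonneg)
  define P where "P = closest_point (cball 0 R :: (real^5) set)"
  obtain L where L: "L-lipschitz_on (cball 0 R) MB_field"
    using MB_field_lipschitz_on_cball[OF nonneg(3)] by blast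
  have P_in: "P z \<in> cball 0 R" for z
    unfolding P_def using nonneg(3) by (intro closest_point_in_set) auto
  \<comment> \<open>The projection is nonexpansive and maps into the ball, so the truncated field is
    globally Lipschitz.\<close>
  have "1-lipschitz_on UNIV P"
    unfolding P_def using closest_point_lipschitz[of "cball 0 R"] nonneg(3)
    by (intro lipschitz_onI) auto
  moreover have "L-lipschitz_on (P ` UNIV) MB_field"
    using P_in by (intro lipschitz_on_subset[OF L]) auto
  ultimately have G: "(L * 1)-lipschitz_on UNIV (\<lambda>z. MB_field (P z))"
    using lipschitz_on_compose[of 1 UNIV P L MB_field] by (simp add: o_def)
  obtain x where x: "continuous_on {0..\<tau>} x"
    and x_eq: "\<And>t. t \<in> {0..\<tau>} \<Longrightarrow> x t = x0 + RL_integral \<alpha> (\<lambda>s. MB_field (P (x s))) t"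
    using volterra_exists[OF assms(1) less_imp_le[OF assms(3)] G, of x0] by blast
  have "\<exists>c. 0 \<le> c \<and> c \<le> 1 \<and> P z = c *\<^sub>R z" for z
    unfolding P_def by (rule closest_point_cball_0[OF nonneg(3), of z]) auto
  then obtain c where c: "0 \<le> c z" "c z \<le> 1" "P z = c z *\<^sub>R z" for z
    by metis
  define g where "g s = MB_field (P (x s))" for s
  have g: "continuous_on {0..\<tau>} g"
    unfolding g_def using lipschitz_on_continuous_on[OF G]
    by (rule continuous_on_compose2[OF _ x]) auto
  have g_cont: "continuous_on {0..t} (\<lambda>s. g s $ i)" if "t \<le> \<tau>" for t i
    using that by (intro continuous_intros continuous_on_subset[OF g]) auto
  have comp: "x t $ i = x0 $ i + RL_integral \<alpha> (\<lambda>s. g s $ i) t" if "t \<in> {0..\<tau>}" for t i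
  proof -
    have "continuous_on {0..t} g" using that by (intro continuous_on_subset[OF g]) auto
    then show ?thesis
      using x_eq[OF that, folded g_def] RL_integral_bounded_linear[OF bounded_linear_vec_nth assms(1), of t g i]
      by simp
  qed
  have energy: "\<bar>x t $ i\<bar> \<le> \<rho>" if "t \<in> {0..\<tau>}" "i \<in> I" for t i
  proof -
    have "(\<Sum>i\<in>I. (x t $ i)\<^sup>2) \<le> (\<Sum>i\<in>I. (x0 $ i)\<^sup>2)"
    proof (rule volterra_energy[where u = "\<lambda>i s. x s $ i", OF assms(1,2)])
      show "continuous_on {0..t} (\<lambda>s. g s $ i)" for i
        using that by (intro g_cont) auto
      show "x s $ i = x0 $ i + RL_integral \<alpha> (\<lambda>s. g s $ i) s" if "s \<in> {0..t}" for i s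
        using that \<open>t \<in> {0..\<tau>}\<close> by (intro comp) auto
      \<comment> \<open>Since \<open>P\<close> is radial, the truncated field has the common factor
        \<open>(c (x s))\<^sup>2\<close> on these components, and the cubic terms cancel.\<close>
      show "(\<Sum>i\<in>I. x s $ i * g s $ i) = 0" for s
        by (simp add: I_def g_def MB_field_components c(3) algebra_simps)
    qed (use that in auto)
    moreover have "(x t $ i)\<^sup>2 \<le> (\<Sum>i\<in>I. (x t $ i)\<^sup>2)"
      using that(2) by (intro member_le_sum) (auto simp: I_def)
    ultimately show ?thesis
      unfolding \<rho>_def by (intro real_le_rsqrt) simp
  qed
  \<comment> \<open>Used for the pairs 1, 3 and 2, 4: component \<open>i\<close> integrates a
    multiple, by a factor in \<open>{0..1}\<close>, of a component bounded by \<open>\<rho>\<close>.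
    The unweighted case \<open>l = 0\<close> of the norm bound suffices.\<close>
  have drift: "\<bar>x t $ i\<bar> \<le> \<bar>x0 $ i\<bar> + \<rho> * \<kappa>" if "t \<in> {0..\<tau>}" "\<And>s. g s $ i = c (x s) * x s $ j" "j \<in> I"
    for t i j
  proof -
    have "norm (RL_integral \<alpha> (\<lambda>s. g s $ i) t) \<le> \<rho> * exp (0 * t) * \<kappa>"
      unfolding \<kappa>_def
    proof (rule norm_RL_integral_le[OF assms(1)])
      fix s assume "s \<in> {0..t}"
      then have "\<bar>x s $ j\<bar> \<le> \<rho>" using that by (intro energy) auto
      then show "norm (g s $ i) \<le> \<rho> * exp (0 * s)"
        using c(1,2)[of "x s"] mult_mono[of "c (x s)" 1 "\<bar>x s $ j\<bar>" \<rho>]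
        by (simp add: that(2) abs_mult)
    qed (use that(1) g_cont in auto)
    then show ?thesis using comp[OF that(1), of i] by simp
  qed
  have "norm (x t) \<le> R" if "t \<in> {0..\<tau>}" for t
  proof -
    have "norm (x t) \<le> (\<Sum>i\<in>UNIV. \<bar>x t $ i\<bar>)" by (rule norm_le_l1_cart)
    also have "\<dots> \<le> R"
      using drift[OF that, of 1 3] drift[OF that, of 2 4] energy[OF that, of 3] energy[OF that, of 4]
        energy[OF that, of 5]
      by (simp add: sum_5 R_def I_def g_def MB_field_components c(3))
    finally show ?thesis .
  qed
  \<comment> \<open>The projection acts trivially along the solution, which therefore solves the
    original system.\<close>
  then have "P (x t) = x t" if "t \<in> {0..\<tau>}" for t
    unfolding P_def using that by (intro closest_point_self) auto
  then have sol: "x t = x0 + RL_integral \<alpha> (\<lambda>s. MB_field (x s)) t" if "t \<in> {0..\<tau>}" for t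
    unfolding x_eq[OF that] using that by (intro arg_cong2[of _ _ _ _ "(+)"] RL_integral_cong) auto
  show ?thesis
  proof (intro exI[of _ x] conjI allI impI ballI)
    show "caputo_ivp_solution \<alpha> MB_field x0 \<tau> x"
      unfolding caputo_ivp_solution_def using sol by (auto intro: continuous_on_subset[OF x])
    fix y t assume y: "caputo_ivp_solution \<alpha> MB_field x0 \<tau> y" and t: "t \<in> {0..<\<tau>}"
    \<comment> \<open>A competitor \<open>y\<close> is only known to be continuous on the half-open
      interval. On the compact \<open>{0..t}\<close> both functions stay in a common ball, whose
      Lipschitz constant may depend on \<open>t\<close> and \<open>y\<close>.\<close>
    have xt: "continuous_on {0..t} x" and yt: "continuous_on {0..t} y"
      using x y t unfolding caputo_ivp_solution_def by (auto intro: continuous_on_subset)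
    obtain M M' where M: "0 \<le> M" "\<And>s. s \<in> {0..t} \<Longrightarrow> norm (x s) \<le> M"
        "\<And>s. s \<in> {0..t} \<Longrightarrow> norm (y s) \<le> M'"
      using bounded_on_Icc[OF xt] bounded_on_Icc[OF yt] by metis
    have "0 \<le> max M M'" using M(1) by simp
    then obtain L where L: "L-lipschitz_on (cball 0 (max M M')) MB_field"
      using MB_field_lipschitz_on_cball by blast
    show "y t = x t"
    proof (rule volterra_unique[OF assms(1) _ L])
      show "y s = x0 + RL_integral \<alpha> (\<lambda>s. MB_field (y s)) s" if "s \<in> {0..t}" for s
        using y t that unfolding caputo_ivp_solution_def by auto
      show "x s = x0 + RL_integral \<alpha> (\<lambda>s. MB_field (x s)) s" if "s \<in> {0..t}" for s
        using sol t that by auto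
    qed (use xt yt M t in \<open>auto simp: le_max_iff_disj\<close>)
  qed
qed

end
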